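(* Let $\mathcal{H}$ be a complex Hilbert space, let $A\in\mathcal{B}(\mathcal{H})$ be a positive operator, let $T\in\mathcal{B}_A(\mathcal{H})$ and let $r\ge 1$ be a real number. Then $$w_A^{2r}(T)\le \frac12\, w_A^r(T^2)+\frac{1}{2^{r+1}}\left\|TT^{\sharp_A}+T^{\sharp_A}T\right\|_A^r .$$
   Context: $\mathcal{H}$ is a complex Hilbert space with inner product $\langle\cdot,\cdot\rangle$ (linear in the first variable), $\mathcal{B}(\mathcal{H})$ is the algebra of bounded linear operators on $\mathcal{H}$, and $A\in\mathcal{B}(\mathcal{H})$ is a positive operator (i.e. $\langle Ax,x\rangle\ge 0$ for all $x$; not necessarily injective or with closed range). Put $\langle x,y\rangle_A=\langle Ax,y\rangle$ and $\|x\|_A=\sqrt{\langle x,x\rangle_A}$. An operator $R\in\mathcal{B}(\mathcal{H})$ is an $A$-adjoint of $T\in\mathcal{B}(\mathcal{H})$ if $\langle Tx,y\rangle_A=\langle x,Ry\rangle_A$ for all $x,y\in\mathcal{H}$. $\mathcal{B}_A(\mathcal{H})$ is the set of all $T\in\mathcal{B}(\mathcal{H})$ admitting an $A$-adjoint; equivalently, $R(T^*A)\subseteq R(A)$, where $R(\cdot)$ denotes range. For $T\in\mathcal{B}_A(\mathcal{H})$, $T^{\sharp_A}$ denotes the unique $A$-adjoint with range contained in $\overline{R(A)}$, i.e. the unique solution $X$ of $AX=T^*A$ with $R(X)\subseteq\overline{R(A)}$. For $T\in\mathcal{B}_A(\mathcal{H})$, the $A$-operator seminorm is $\|T\|_A=\sup\{\|Tx\|_A: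 x\in\mathcal{H},\ \|x\|_A=1\}$ and the $A$-numerical radius is $w_A(T)=\sup\{|\langle Tx,x\rangle_A|: x\in\mathcal{H},\ \|x\|_A=1\}$. Powers such as $w_A^{s}(T)$ mean $(w_A(T))^{s}$, and $\|\cdot\|_A^r$ means $(\|\cdot\|_A)^r$. *)

theory Defs
  imports "HOL-Analysis.Analysis"
begin

class complex_inner = real_normed_vector +
  fixes scaleC :: "complex \<Rightarrow> 'a \<Rightarrow> 'a"  (infixr \<open>*\<^sub>C\<close> 75)
    and cinner :: "'a \<Rightarrow> 'a \<Rightarrow> complex"
  assumes scaleC_add_right: "a *\<^sub>C (x + y) = a *\<^sub>C x + a *\<^sub>C y"
    and scaleC_add_left: "(a + b) *\<^sub>C x = a *\<^sub>C x + b *\<^sub>C x"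
    and scaleC_scaleC: "a *\<^sub>C (b *\<^sub>C x) = (a * b) *\<^sub>C x"
    and scaleC_one: "1 *\<^sub>C x = x"
    and scaleR_scaleC: "scaleR r x = complex_of_real r *\<^sub>C x"
    and cinner_commute: "cinner x y = cnj (cinner y x)"
    and cinner_add_left: "cinner (x + y) z = cinner x z + cinner y z"
    and cinner_scaleC_left: "cinner (a *\<^sub>C x) y = a * cinner x y"
    and norm_eq_sqrt_cinner: "norm x = sqrt (Re (cinner x x))"
    \<comment> \<open>Positive definiteness of \<open>cinner\<close> follows from the last axiom and the norm axioms.\<close>

class complex_hilbert = complex_inner + complete_space

instantiation complex :: complex_hilbert
begin
definition scaleC_complex :: "complex \<Rightarrow> complex \<Rightarrow> complex"
  where "scaleC_complex a x = a * x"
definition cinner_complex :: "complex \<Rightarrow> complex \<Rightarrow> complex"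
  where "cinner_complex x y = x * cnj y"
instance
  by standard
    (auto simp: scaleC_complex_def cinner_complex_def algebra_simps scaleR_conv_of_real
      complex_norm_square[symmetric] cmod_def power2_eq_square)
end

definition bounded_clinear :: "('a::complex_inner \<Rightarrow> 'a) \<Rightarrow> bool"
  where "bounded_clinear T \<longleftrightarrow> bounded_linear T \<and> (\<forall>c x. T (c *\<^sub>C x) = c *\<^sub>C T x)"

definition positive_op :: "('a::complex_inner \<Rightarrow> 'a) \<Rightarrow> bool"
  where "positive_op A \<longleftrightarrow> bounded_clinear A \<and> (\<forall>x. cinner (A x) x \<in> \<real>\<^sub>\<ge>\<^sub>0)"

definition A_inner :: "('a::complex_inner \<Rightarrow> 'a) \<Rightarrow> 'a \<Rightarrow> 'a \<Rightarrow> complex"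
  where "A_inner A x y = cinner (A x) y"

definition A_norm :: "('a::complex_inner \<Rightarrow> 'a) \<Rightarrow> 'a \<Rightarrow> real"
  where "A_norm A x = sqrt (Re (A_inner A x x))"

definition is_A_adjoint :: "('a::complex_inner \<Rightarrow> 'a) \<Rightarrow> ('a \<Rightarrow> 'a) \<Rightarrow> ('a \<Rightarrow> 'a) \<Rightarrow> bool"
  where "is_A_adjoint A T R \<longleftrightarrow>
    bounded_clinear R \<and> (\<forall>x y. A_inner A (T x) y = A_inner A x (R y))"

definition A_adjointable :: "('a::complex_inner \<Rightarrow> 'a) \<Rightarrow> ('a \<Rightarrow> 'a) set"
  where "A_adjointable A = {T. bounded_clinear T \<and> (\<exists>R. is_A_adjoint A T R)}"

definition A_adj :: "('a::complex_inner \<Rightarrow> 'a) \<Rightarrow> ('a \<Rightarrow> 'a) \<Rightarrow> ('a \<Rightarrow> 'a)"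
  where "A_adj A T = (THE R. is_A_adjoint A T R \<and> range R \<subseteq> closure (range A))"

text \<open>
  The suprema below are of sets of nonnegative reals, taken in $[0,\infty)$. If \<open>A = 0\<close>, no vector
  has \<open>A\<close>-seminorm 1 and the supremum of the empty set is 0; \<open>Sup {}\<close> is unspecified on
  type \<open>real\<close>. On \<open>A_adjointable A\<close> the sets are bounded above.
\<close>

definition nonneg_Sup :: "real set \<Rightarrow> real"
  where "nonneg_Sup S = (if S = {} then 0 else Sup S)"

definition A_opnorm :: "('a::complex_inner \<Rightarrow> 'a) \<Rightarrow> ('a \<Rightarrow> 'a) \<Rightarrow> real"
  where "A_opnorm A T = nonneg_Sup {A_norm A (T x) | x. A_norm A x = 1}"

definition A_numradius :: "('a::complex_inner \<Rightarrow> 'a) \<Rightarrow> ('a \<Rightarrow> 'a) \<Rightarrow> real"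
  where "A_numradius A T = nonneg_Sup {cmod (A_inner A (T x) x) | x. A_norm A x = 1}"

end

theory Submission
  imports Defs
begin

text \<open>
  Apply Buzano's inequality for \<open>\<langle>\<cdot>, \<cdot>\<rangle>\<^sub>A\<close> to \<open>Tx\<close>, the unit vector \<open>x\<close> and \<open>T\<^sup>\<sharp>x\<close>: it bounds
  \<open>\<bar>\<langle>Tx, x\<rangle>\<^sub>A\<bar>\<^sup>2\<close> by the mean of \<open>\<bar>\<langle>T\<^sup>2x, x\<rangle>\<^sub>A\<bar>\<close> and \<open>\<parallel>Tx\<parallel>\<^sub>A \<parallel>T\<^sup>\<sharp>x\<parallel>\<^sub>A\<close>. By AM-GM the last product is at most
  half of \<open>\<parallel>Tx\<parallel>\<^sub>A\<^sup>2 + \<parallel>T\<^sup>\<sharp>x\<parallel>\<^sub>A\<^sup>2 = \<langle>(TT\<^sup>\<sharp> + T\<^sup>\<sharp>T)x, x\<rangle>\<^sub>A\<close>. Convexity of \<open>t \<mapsto> t\<^sup>r\<close> gives the claim for all \<open>r \<ge> 1\<close>.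
  The suprema are finite because \<open>T\<^sup>\<sharp>T\<close> and \<open>TT\<^sup>\<sharp> + T\<^sup>\<sharp>T\<close> are symmetric for \<open>\<langle>\<cdot>, \<cdot>\<rangle>\<^sub>A\<close> and a norm-bounded
  symmetric operator is bounded for \<open>\<parallel>\<cdot>\<parallel>\<^sub>A\<close>. The operator \<open>T\<^sup>\<sharp>\<close> exists because composing any
  \<open>A\<close>-adjoint with the orthogonal projection onto the closure of the range of \<open>A\<close> gives an
  \<open>A\<close>-adjoint.
\<close>

section \<open>Two elementary real inequalities\<close>

lemma quadratic_nonneg_discriminant:
  fixes a b c :: real
  assumes nonneg: "\<And>t. 0 \<le> a + 2 * t * b + t\<^sup>2 * c" and c: "0 \<le> c"
  shows "b\<^sup>2 \<le> a * c"
proof (cases "c = 0")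
  case True
  have "b = 0"
  proof (rule ccontr)
    assume "b \<noteq> 0"
    \<comment> \<open>For \<open>c = 0\<close> the expression is affine in \<open>t\<close>, and the
      chosen \<open>t\<close> makes it equal to -1.\<close>
    then show False
      using nonneg[of "- (a + 1) / (2 * b)"] True by (simp add: field_simps)
  qed
  with True show ?thesis by simp
next
  case False
  with c have "0 < c" by simp
  \<comment> \<open>The vertex of the parabola, where its value is
    \<open>a - b\<^sup>2 / c\<close>.\<close>
  with nonneg[of "- b / c"] show ?thesis
    by (simp add: field_simps power2_eq_square)
qed

text \<open>Positive arguments are settled by convexity of the power on the open half-line; if one
  argument is 0, the claim reduces to \<open>2 \<le> 2 powr r\<close>.\<close>

lemma powr_mean_le:
  fixes a b r :: real
  assumes a: "0 \<le> a" and b: "0 \<le> b" and r: "1 \<le> r"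
  shows "((a + b) / 2) powr r \<le> (a powr r + b powr r) / 2"
proof (cases "a = 0 \<or> b = 0")
  case False
  with a b have "a \<in> {0<..}" "b \<in> {0<..}" by auto
  from convex_onD[OF powr_convex[OF r], of "1 / 2", OF _ _ this] show ?thesis
    by (simp add: field_simps)
next
  case True
  have half: "(c / 2) powr r \<le> c powr r / 2" if "0 \<le> c" for c :: real
  proof -
    have "2 powr 1 \<le> (2::real) powr r" using r by (intro powr_mono) auto
    then have "c powr r / 2 powr r \<le> c powr r / 2" by (intro divide_left_mono) auto
    then show ?thesis using that by (simp add: powr_divide)
  qed
  from True show ?thesis using half[OF a] half[OF b] r by auto
qed

section \<open>Semi-inner products, Buzano's inequality and symmetric operators\<close>

lemma scaleC_minus_one [simp]: "(- 1) *\<^sub>C x = - (x::'a::complex_inner)"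
  using scaleR_scaleC[of "- 1" x] by simp

text \<open>Semidefinite forms give a common setting for \<open>cinner\<close> and for
  \<open>A_inner A\<close>, which degenerates on the kernel of \<open>A\<close>.\<close>

locale semi_inner =
  fixes ip :: "'a::complex_inner \<Rightarrow> 'a \<Rightarrow> complex"
  assumes add_left: "ip (x + y) z = ip x z + ip y z"
    and scaleC_left: "ip (c *\<^sub>C x) y = c * ip x y"
    and commute: "ip x y = cnj (ip y x)"
    and nonneg: "0 \<le> Re (ip x x)"
begin

definition snorm :: "'a \<Rightarrow> real"
  where "snorm x = sqrt (Re (ip x x))"

lemma add_right: "ip x (y + z) = ip x y + ip x z"
  by (metis add_left commute complex_cnj_add)

lemma scaleC_right: "ip x (c *\<^sub>C y) = cnj c * ip x y"
  by (metis commute complex_cnj_mult scaleC_left)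

lemma minus_left: "ip (- x) y = - ip x y"
  using scaleC_left[of "- 1" x y] by simp

lemma minus_right: "ip x (- y) = - ip x y"
  using scaleC_right[of x "- 1" y] by simp

lemma diff_left: "ip (x - y) z = ip x z - ip y z"
  using add_left[of x "- y" z] by (simp add: minus_left)

lemma diff_right: "ip x (y - z) = ip x y - ip x z"
  using add_right[of x y "- z"] by (simp add: minus_right)

lemma scaleR_left: "ip (t *\<^sub>R x) y = of_real t * ip x y"
  by (simp add: scaleR_scaleC scaleC_left)

lemma scaleR_right: "ip x (t *\<^sub>R y) = of_real t * ip x y"
  by (simp add: scaleR_scaleC scaleC_right)

lemma Re_commute: "Re (ip x y) = Re (ip y x)"
  by (metis commute cnj.simps(1))

lemma snorm_nonneg [simp]: "0 \<le> snorm x"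
  by (simp add: snorm_def nonneg)

lemma snorm_sq: "(snorm x)\<^sup>2 = Re (ip x x)"
  by (simp add: snorm_def nonneg)

lemma ip_self: "ip x x = of_real ((snorm x)\<^sup>2)"
proof -
  have "Im (ip x x) = 0" using commute[of x x] by (metis cnj.simps(2) neg_equal_zero)
  then show ?thesis by (simp add: snorm_sq complex_eq_iff)
qed

lemma quadratic_expand:
  "Re (ip (x + t *\<^sub>R y) (x + t *\<^sub>R y)) = Re (ip x x) + 2 * t * Re (ip x y) + t\<^sup>2 * Re (ip y y)"
  using Re_commute[of x y]
  by (simp add: add_left add_right scaleR_left scaleR_right algebra_simps power2_eq_square)

lemma Re_Cauchy_Schwarz: "Re (ip x y) \<le> snorm x * snorm y"
proof -
  have "(Re (ip x y))\<^sup>2 \<le> Re (ip x x) * Re (ip y y)"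
    by (rule quadratic_nonneg_discriminant) (metis nonneg quadratic_expand, rule nonneg)
  also have "\<dots> = (snorm x * snorm y)\<^sup>2"
    by (simp add: power_mult_distrib snorm_sq)
  finally show ?thesis by (rule power2_le_imp_le) simp
qed

lemma Cauchy_Schwarz: "cmod (ip x y) \<le> snorm x * snorm y"
proof (cases "ip x y = 0")
  case False
  \<comment> \<open>A phase that rotates \<open>x\<close> so that the product with \<open>y\<close>
    becomes real and nonnegative; the bound on real parts then suffices.\<close>
  define c where "c = cnj (ip x y) / of_real (cmod (ip x y))"
  have c: "cmod c = 1" using False by (simp add: c_def norm_divide)
  have "c * ip x y = (ip x y * cnj (ip x y)) / of_real (cmod (ip x y))"
    by (simp add: c_def)
  also have "\<dots> = of_real (cmod (ip x y))"
    using False by (simp add: complex_norm_square[symmetric] power2_eq_square)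
  finally have "c * ip x y = of_real (cmod (ip x y))" .
  then have "cmod (ip x y) = Re (ip (c *\<^sub>C x) y)" by (simp add: scaleC_left)
  also have "\<dots> \<le> snorm (c *\<^sub>C x) * snorm y" by (rule Re_Cauchy_Schwarz)
  also have "snorm (c *\<^sub>C x) = snorm x"
  proof -
    have cc: "c * cnj c = 1" using complex_norm_square[of c] c by simp
    have "ip (c *\<^sub>C x) (c *\<^sub>C x) = (c * cnj c) * ip x x"
      by (simp only: scaleC_left scaleC_right ac_simps)
    then show ?thesis by (simp only: snorm_def cc mult_1_left)
  qed
  finally show ?thesis .
qed simp

text \<open>Reflection across the line spanned by \<open>e\<close> preserves the seminorm, so
  \<open>2\<langle>a, e\<rangle>\<langle>e, b\<rangle> - \<langle>a, b\<rangle>\<close> is controlled by Cauchy-Schwarz.\<close>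
lemma Buzano:
  assumes e: "snorm e = 1"
  shows "cmod (ip a e * ip e b) \<le> (snorm a * snorm b + cmod (ip a b)) / 2"
proof -
  define a' where "a' = (2 * ip a e) *\<^sub>C e - a"
  have ee: "ip e e = 1" using ip_self[of e] e by simp
  have "ip a' a' = ip a a"
    unfolding a'_def using commute[of e a]
    by (simp add: diff_left diff_right scaleC_left scaleC_right ee algebra_simps)
  then have a': "snorm a' = snorm a" by (simp add: snorm_def)
  have "2 * (ip a e * ip e b) = ip a' b + ip a b"
    by (simp add: a'_def diff_left scaleC_left)
  then have "2 * cmod (ip a e * ip e b) = cmod (ip a' b + ip a b)"
    by (metis norm_mult norm_numeral)
  also have "\<dots> \<le> snorm a * snorm b + cmod (ip a b)"
    using norm_triangle_ineq[of "ip a' b" "ip a b"] Cauchy_Schwarz[of a' b] a' by simp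
  finally show ?thesis by simp
qed

text \<open>By symmetry \<open>n \<mapsto> snorm ((B ^^ n) x)\<close> is log-convex, so it grows at least as fast as the
  powers of \<open>snorm (B x) / snorm x\<close>; on the other hand it grows at most as fast as those of \<open>M\<close>.\<close>
lemma symmetric_snorm_le:
  assumes sym: "\<And>x y. ip (B x) y = ip x (B y)"
    and B: "\<And>x. norm (B x) \<le> M * norm x" and M: "0 < M"
    and C: "\<And>x. snorm x \<le> C * norm x" "0 \<le> C"
  shows "snorm (B x) \<le> M * snorm x"
proof -
  define g where "g n = snorm ((B ^^ n) x)" for n
  have g0: "0 \<le> g n" for n by (simp add: g_def)
  have logconvex: "(g (Suc n))\<^sup>2 \<le> g n * g (Suc (Suc n))" for n
  proof -
    have "(g (Suc n))\<^sup>2 = Re (ip ((B ^^ n) x) ((B ^^ Suc (Suc n)) x))"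
      by (simp add: g_def snorm_sq sym)
    also have "\<dots> \<le> g n * g (Suc (Suc n))"
      unfolding g_def by (rule Re_Cauchy_Schwarz)
    finally show ?thesis .
  qed
  have "g 1 \<le> M * g 0"
  proof (cases "g 0 = 0")
    \<comment> \<open>Log-convexity at 0 reads \<open>(g 1)\<^sup>2 \<le> g 0 * g 2 = 0\<close>, so
      null vectors are mapped to null vectors.\<close>
    case True
    with logconvex[of 0] show ?thesis by simp
  next
    case False
    with g0[of 0] have pos: "0 < g 0" by linarith
    define q where "q = g 1 / g 0"
    have q: "0 \<le> q" using g0 by (simp add: q_def)
    have step: "q * g n \<le> g (Suc n)" for n
    proof (induction n)
      case 0
      then show ?case using pos by (simp add: q_def)
    next
      case (Suc n)
      show ?case
      proof (cases "g (Suc n) = 0")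
        case True
        then show ?thesis using g0 by simp
      next
        case False
        with g0[of "Suc n"] have "0 < g (Suc n)" by linarith
        \<comment> \<open>The extra factor \<open>g (Suc n)\<close> lets log-convexity and the
          induction hypothesis combine; being positive, it cancels afterwards.\<close>
        moreover have "(q * g (Suc n)) * g (Suc n) \<le> g (Suc (Suc n)) * g (Suc n)"
        proof -
          have "(q * g (Suc n)) * g (Suc n) \<le> q * (g n * g (Suc (Suc n)))"
            using mult_left_mono[OF logconvex q] by (simp add: power2_eq_square mult.assoc)
          also have "\<dots> \<le> g (Suc (Suc n)) * g (Suc n)"
            using mult_right_mono[OF Suc g0[of "Suc (Suc n)"]] by (simp add: algebra_simps)
          finally show ?thesis .
        qed
        ultimately show ?thesis by simp
      qed
    qed
    have lower: "q ^ n * g 0 \<le> g n" for n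
    proof (induction n)
      case (Suc n)
      have "q ^ Suc n * g 0 = q * (q ^ n * g 0)" by simp
      also have "\<dots> \<le> q * g n" by (rule mult_left_mono[OF Suc q])
      also have "\<dots> \<le> g (Suc n)" by (rule step)
      finally show ?case .
    qed simp
    have iter: "norm ((B ^^ n) x) \<le> M ^ n * norm x" for n
    proof (induction n)
      case (Suc n)
      have "norm ((B ^^ Suc n) x) \<le> M * norm ((B ^^ n) x)" using B by simp
      also have "\<dots> \<le> M * (M ^ n * norm x)" using Suc M by simp
      finally show ?case by (simp add: mult.assoc)
    qed simp
    \<comment> \<open>\<open>C\<close> enters once and not at every iterate, so it does not affect
      the comparison of growth rates.\<close>
    have upper: "g n \<le> C * (M ^ n * norm x)" for n
      unfolding g_def using C(1)[of "(B ^^ n) x"] mult_left_mono[OF iter C(2), of n] by linarith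
    have "q \<le> M"
    proof (rule ccontr)
      assume "\<not> q \<le> M"
      then have "1 < q / M" using M by simp
      then obtain n where n: "C * norm x / g 0 < (q / M) ^ n"
        using real_arch_pow by blast
      have "q ^ n * g 0 \<le> C * norm x * M ^ n"
        using lower[of n] upper[of n] by (simp add: algebra_simps)
      then have "(q / M) ^ n \<le> C * norm x / g 0"
        using pos M by (simp add: field_simps power_divide)
      with n show False by simp
    qed
    then show ?thesis using pos by (simp add: q_def field_simps)
  qed
  then show ?thesis by (simp add: g_def)
qed

end

section \<open>Orthogonal projection in Hilbert space\<close>

global_interpretation cinner: semi_inner cinner
  rewrites "semi_inner.snorm cinner = norm"
proof -
  \<comment> \<open>\<open>sqrt\<close> is odd on the reals, so \<open>norm x \<ge> 0\<close>
    already forces its argument to be nonnegative.\<close>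
  have Re_nonneg: "0 \<le> Re (cinner x x)" for x :: 'a
    using norm_eq_sqrt_cinner[of x] by (metis norm_ge_zero real_sqrt_ge_0_iff)
  show *: "semi_inner (cinner :: 'a \<Rightarrow> _)"
    by unfold_locales
      (simp_all add: cinner_add_left cinner_scaleC_left Re_nonneg, rule cinner_commute)
  show "semi_inner.snorm cinner = (norm :: 'a \<Rightarrow> _)"
    by (rule ext) (simp add: semi_inner.snorm_def[OF *] norm_eq_sqrt_cinner)
qed

lemma norm_scaleC: "norm (c *\<^sub>C x) = cmod c * norm (x::'a::complex_inner)"
proof -
  have "(norm (c *\<^sub>C x))\<^sup>2 = Re ((c * cnj c) * cinner x x)"
    by (simp add: cinner.snorm_sq cinner.scaleC_left cinner.scaleC_right ac_simps)
  also have "\<dots> = (cmod c * norm x)\<^sup>2"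
    by (simp add: complex_norm_square[symmetric] cinner.ip_self power_mult_distrib
        flip: of_real_power of_real_mult)
  finally have "(norm (c *\<^sub>C x))\<^sup>2 = (cmod c * norm x)\<^sup>2" .
  then show ?thesis by (simp add: power2_eq_iff_nonneg)
qed

lemma bounded_linear_scaleC: "bounded_linear (\<lambda>x. c *\<^sub>C (x::'a::complex_inner))"
  by (rule bounded_linear_intro[where K = "cmod c"])
    (simp_all add: scaleC_add_right scaleR_scaleC scaleC_scaleC norm_scaleC mult.commute)

lemma parallelogram_law:
  fixes x y :: "'a::complex_inner"
  shows "(norm (x + y))\<^sup>2 + (norm (x - y))\<^sup>2 = 2 * (norm x)\<^sup>2 + 2 * (norm y)\<^sup>2"
  unfolding cinner.snorm_sq
  by (simp add: cinner.add_left cinner.add_right cinner.diff_left cinner.diff_right)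

lemma subspace_closure:
  fixes M :: "'a::real_normed_vector set"
  assumes M: "subspace M"
  shows "subspace (closure M)"
proof (rule subspaceI)
  show "0 \<in> closure M" using subspace_0[OF M] closure_subset by blast
next
  fix x y assume "x \<in> closure M" "y \<in> closure M"
  then obtain u v where "\<And>n. u n \<in> M" "u \<longlonglongrightarrow> x" "\<And>n. v n \<in> M" "v \<longlonglongrightarrow> y"
    unfolding closure_sequential by blast
  then have "\<forall>n. u n + v n \<in> M" "(\<lambda>n. u n + v n) \<longlonglongrightarrow> x + y"
    by (auto intro: subspace_add[OF M] tendsto_add)
  then show "x + y \<in> closure M" unfolding closure_sequential by (intro exI conjI)
next
  fix c x assume "x \<in> closure M"
  then obtain u where "\<And>n. u n \<in> M" "u \<longlonglongrightarrow> x" unfolding closure_sequential by blast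
  then have "\<forall>n. c *\<^sub>R u n \<in> M" "(\<lambda>n. c *\<^sub>R u n) \<longlonglongrightarrow> c *\<^sub>R x"
    by (auto intro: subspace_scale[OF M] tendsto_scaleR)
  then show "c *\<^sub>R x \<in> closure M" unfolding closure_sequential by (intro exI conjI)
qed

text \<open>Midpoints of a minimizing sequence stay in \<open>M\<close>, so the parallelogram law
  makes the sequence Cauchy; its limit is a nearest point.\<close>

lemma closed_subspace_nearest:
  fixes M :: "'a::complex_hilbert set"
  assumes M: "subspace M" "closed M"
  shows "\<exists>m\<in>M. \<forall>z\<in>M. norm (y - m) \<le> norm (y - z)"
proof -
  define D where "D = (\<lambda>z. (norm (y - z))\<^sup>2) ` M"
  have bdd: "bdd_below D" unfolding D_def by (rule bdd_belowI[of _ 0]) auto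
  have ne: "D \<noteq> {}" using subspace_0[OF M(1)] by (auto simp: D_def)
  have lower: "Inf D \<le> (norm (y - z))\<^sup>2" if "z \<in> M" for z
    using that by (intro cInf_lower bdd) (auto simp: D_def)
  have "\<exists>m\<in>M. (norm (y - m))\<^sup>2 < Inf D + 1 / real (Suc n)" for n
    using cInf_lessD[OF ne, of "Inf D + 1 / real (Suc n)"] by (auto simp: D_def)
  then obtain m where m: "\<And>n. m n \<in> M"
    and m_le: "\<And>n. (norm (y - m n))\<^sup>2 < Inf D + 1 / real (Suc n)" by metis
  have close: "(norm (m i - m j))\<^sup>2 \<le> 2 / real (Suc i) + 2 / real (Suc j)" for i j
  proof -
    have "(1 / 2) *\<^sub>R (m i + m j) \<in> M" using m M(1) by (intro subspace_scale subspace_add)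
    from lower[OF this] have "4 * Inf D \<le> (2 * norm (y - (1 / 2) *\<^sub>R (m i + m j)))\<^sup>2"
      by (simp add: power_mult_distrib)
    also have "2 * norm (y - (1 / 2) *\<^sub>R (m i + m j)) = norm (2 *\<^sub>R (y - (1 / 2) *\<^sub>R (m i + m j)))"
      by simp
    also have "2 *\<^sub>R (y - (1 / 2) *\<^sub>R (m i + m j)) = (y - m i) + (y - m j)"
      by (simp add: scaleR_diff_right scaleR_2)
    finally have "4 * Inf D \<le> (norm ((y - m i) + (y - m j)))\<^sup>2" .
    moreover have "norm ((y - m i) - (y - m j)) = norm (m i - m j)"
      by (simp add: norm_minus_commute)
    ultimately show ?thesis
      using parallelogram_law[of "y - m i" "y - m j"] m_le[of i] m_le[of j] by simp
  qed
  have "Cauchy m"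
  proof (rule CauchyI)
    fix e :: real
    assume e: "0 < e"
    \<comment> \<open>Beyond \<open>N\<close> both terms of \<open>close\<close> are at most
      \<open>2 / real (Suc N)\<close>, hence the quarter of \<open>e\<^sup>2\<close>.\<close>
    then obtain N where N: "1 / real (Suc N) < e\<^sup>2 / 4"
      using nat_approx_posE[of "e\<^sup>2 / 4"] by auto
    have "norm (m i - m j) < e" if "N \<le> i" "N \<le> j" for i j
    proof -
      have "1 / real (Suc i) \<le> 1 / real (Suc N)" "1 / real (Suc j) \<le> 1 / real (Suc N)"
        using that by (auto intro!: divide_left_mono)
      then have "(norm (m i - m j))\<^sup>2 < e\<^sup>2" using close[of i j] N by simp
      then show ?thesis using e by (simp add: power_less_imp_less_base)
    qed
    then show "\<exists>N. \<forall>i\<ge>N. \<forall>j\<ge>N. norm (m i - m j) < e" by blast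
  qed
  then obtain l where l: "m \<longlonglongrightarrow> l" using Cauchy_convergent convergent_def by blast
  have "l \<in> M" using closed_sequentially[OF M(2)] m l by blast
  moreover have "(norm (y - l))\<^sup>2 \<le> Inf D"
  proof (rule LIMSEQ_le)
    show "(\<lambda>n. (norm (y - m n))\<^sup>2) \<longlonglongrightarrow> (norm (y - l))\<^sup>2"
      by (intro tendsto_intros l)
    show "(\<lambda>n. Inf D + 1 / real (Suc n)) \<longlonglongrightarrow> Inf D"
      using tendsto_add[OF tendsto_const[of "Inf D"] LIMSEQ_inverse_real_of_nat]
      by (simp add: inverse_eq_divide)
  qed (use m_le less_imp_le in blast)
  ultimately show ?thesis
    by (meson lower norm_ge_zero order_trans power2_le_imp_le)
qed

text \<open>Moving the nearest point along \<open>z\<close> gives a nonnegative quadratic in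
  \<open>t\<close> without constant term, so its linear coefficient vanishes. This kills the real
  part; replacing \<open>z\<close> by \<open>\<i> *\<^sub>C z\<close> kills the imaginary part. As
  \<open>subspace\<close> is real-linear, \<open>cM\<close> supplies complex scaling.\<close>

lemma closed_subspace_orthogonal_decomposition:
  fixes M :: "'a::complex_hilbert set"
  assumes M: "subspace M" "closed M" and cM: "\<And>c z. z \<in> M \<Longrightarrow> c *\<^sub>C z \<in> M"
  shows "\<exists>m\<in>M. \<forall>z\<in>M. cinner (y - m) z = 0"
proof -
  obtain m where m: "m \<in> M" and min: "\<And>z. z \<in> M \<Longrightarrow> norm (y - m) \<le> norm (y - z)"
    using closed_subspace_nearest[OF M] by blast
  have Re0: "Re (cinner (y - m) z) = 0" if z: "z \<in> M" for z
  proof -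
    have "0 \<le> 0 + 2 * t * Re (cinner (y - m) z) + t\<^sup>2 * Re (cinner z z)" for t
    proof -
      have "m - t *\<^sub>R z \<in> M" using m z M(1) by (intro subspace_diff subspace_scale)
      from min[OF this] have "(norm (y - m))\<^sup>2 \<le> (norm (y - m + t *\<^sub>R z))\<^sup>2"
        by (intro power_mono) (auto simp: algebra_simps)
      then show ?thesis unfolding cinner.snorm_sq cinner.quadratic_expand by simp
    qed
    then have "(Re (cinner (y - m) z))\<^sup>2 \<le> 0 * Re (cinner z z)"
      by (rule quadratic_nonneg_discriminant) (rule cinner.nonneg)
    then show ?thesis by simp
  qed
  have "cinner (y - m) z = 0" if z: "z \<in> M" for z
    using Re0[OF z] Re0[OF cM[OF z, of \<i>]]
    by (simp add: cinner.scaleC_right complex_eq_iff)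
  with m show ?thesis by blast
qed

text \<open>The foot of the perpendicular is unique, which makes the pointwise choice of
  \<open>P\<close> linear; Cauchy-Schwarz gives the norm bound 1.\<close>

lemma orthogonal_projection_exists:
  fixes M :: "'a::complex_hilbert set"
  assumes M: "subspace M" "closed M" and cM: "\<And>c z. z \<in> M \<Longrightarrow> c *\<^sub>C z \<in> M"
  obtains P where "bounded_clinear P" "\<And>x. P x \<in> M"
    "\<And>x z. z \<in> M \<Longrightarrow> cinner (x - P x) z = 0"
proof -
  obtain P where P: "\<And>x. P x \<in> M" and orth: "\<And>x z. z \<in> M \<Longrightarrow> cinner (x - P x) z = 0"
    using closed_subspace_orthogonal_decomposition[OF M cM] by metis
  have unique: "P x = m" if "m \<in> M" "\<And>z. z \<in> M \<Longrightarrow> cinner (x - m) z = 0" for x m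
  proof -
    have d: "P x - m \<in> M" using P that(1) M(1) by (intro subspace_diff)
    have "cinner (P x - m) (P x - m) = cinner (x - m) (P x - m) - cinner (x - P x) (P x - m)"
      by (simp add: cinner.diff_left)
    also have "\<dots> = 0" using orth[OF d] that(2)[OF d] by simp
    finally show ?thesis using cinner.ip_self[of "P x - m"] by simp
  qed
  have inner_P: "cinner (P x) z = cinner x z" if "z \<in> M" for x z
    using orth[OF that, of x] by (simp add: cinner.diff_left)
  have add: "P (x + y) = P x + P y" for x y
    by (rule unique) (simp_all add: subspace_add M(1) P cinner.diff_left cinner.add_left inner_P)
  have scale: "P (c *\<^sub>C x) = c *\<^sub>C P x" for c x
    by (rule unique) (simp_all add: cM P cinner.diff_left cinner.scaleC_left inner_P)
  have "norm (P x) \<le> norm x" for x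
  proof -
    have "(norm (P x))\<^sup>2 = Re (cinner x (P x))"
      unfolding cinner.snorm_sq by (simp add: inner_P P)
    also have "\<dots> \<le> norm x * norm (P x)" by (rule cinner.Re_Cauchy_Schwarz)
    finally show ?thesis
      by (cases "P x = 0") (auto simp: power2_eq_square)
  qed
  then have "bounded_linear P"
    by (intro bounded_linear_intro[where K = 1]) (simp_all add: add scale scaleR_scaleC)
  then have "bounded_clinear P" using scale by (simp add: bounded_clinear_def)
  then show ?thesis using that P orth by blast
qed

section \<open>The form induced by \<open>A\<close>, its adjoints and its symmetric
  operators\<close>

lemma bounded_clinear_add: "bounded_clinear F \<Longrightarrow> F (x + y) = F x + F y"
  by (simp add: bounded_clinear_def bounded_linear.linear linear_add)

lemma bounded_clinear_compose:
  "bounded_clinear F \<Longrightarrow> bounded_clinear G \<Longrightarrow> bounded_clinear (\<lambda>x. F (G x))"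
  by (simp add: bounded_clinear_def bounded_linear_compose)

lemma bounded_clinear_sum:
  "bounded_clinear F \<Longrightarrow> bounded_clinear G \<Longrightarrow> bounded_clinear (\<lambda>x. F x + G x)"
  by (simp add: bounded_clinear_def bounded_linear_add scaleC_add_right)

lemma bounded_clinear_bound:
  assumes "bounded_clinear F"
  obtains K where "0 < K" "\<And>x. norm (F x) \<le> K * norm x"
  using assms bounded_linear.pos_bounded[of F]
  by (auto simp: bounded_clinear_def mult.commute)

text \<open>Hermitian symmetry of a form that is real on the diagonal: polarize with
  \<open>x + y\<close> and \<open>x + \<i> y\<close>.\<close>
lemma positive_op_hermitian:
  assumes A: "positive_op A"
  shows "cinner (A x) y = cnj (cinner (A y) x)"
proof -
  have lin: "A (u + v) = A u + A v" "A (c *\<^sub>C u) = c *\<^sub>C A u" for u v c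
    using A by (simp_all add: positive_op_def bounded_clinear_add) (simp add: bounded_clinear_def)
  have Im0: "Im (cinner (A u) u) = 0" for u
    using A by (auto simp: positive_op_def complex_nonneg_Reals_iff)
  show ?thesis
    using Im0[of "x + y"] Im0[of "x + \<i> *\<^sub>C y"] Im0[of x] Im0[of y]
    by (simp add: lin cinner.add_left cinner.add_right cinner.scaleC_left cinner.scaleC_right
        complex_eq_iff)
qed

lemma positive_op_semi_inner:
  assumes A: "positive_op A"
  shows "semi_inner (A_inner A)"
proof
  fix x y z :: 'a and c
  show "A_inner A (x + y) z = A_inner A x z + A_inner A y z"
    using A by (simp add: A_inner_def positive_op_def bounded_clinear_add cinner.add_left)
  show "A_inner A (c *\<^sub>C x) y = c * A_inner A x y"
    using A by (simp add: A_inner_def positive_op_def bounded_clinear_def cinner.scaleC_left)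
  show "A_inner A x y = cnj (A_inner A y x)"
    unfolding A_inner_def by (rule positive_op_hermitian[OF A])
  show "0 \<le> Re (A_inner A x x)"
    using A by (auto simp: A_inner_def positive_op_def complex_nonneg_Reals_iff)
qed

lemma snorm_A_inner: "positive_op A \<Longrightarrow> semi_inner.snorm (A_inner A) = A_norm A"
  by (rule ext) (simp add: semi_inner.snorm_def[OF positive_op_semi_inner] A_norm_def)

text \<open>The description in \<open>A_adj\<close> requires existence and uniqueness. For
  uniqueness, the difference of two candidate values is orthogonal to \<open>range A\<close> and
  lies in its closure, hence is orthogonal to itself.\<close>

lemma A_adj_is_A_adjoint:
  fixes A T :: "'a::complex_hilbert \<Rightarrow> 'a"
  assumes A: "positive_op A" and T: "T \<in> A_adjointable A"
  shows "is_A_adjoint A T (A_adj A T)"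
proof -
  let ?M = "closure (range A)"
  have cA: "bounded_clinear A" using A by (simp add: positive_op_def)
  have herm: "cinner (A x) y = cinner x (A y)" for x y
    using positive_op_hermitian[OF A, of x y] cinner.commute[of x "A y"] by simp
  have ker: "cinner d z = 0" if d: "\<And>x. cinner (A x) d = 0" and z: "z \<in> ?M" for d z
  proof -
    have "cmod (cinner d z) \<le> 0 + e" if "0 < e" for e
    proof -
      \<comment> \<open>The added 1 keeps the denominator positive when
        \<open>d = 0\<close>.\<close>
      have "0 < e / (norm d + 1)" using that by (simp add: add_nonneg_pos)
      then obtain x where x: "dist (A x) z < e / (norm d + 1)"
        using z unfolding closure_approachable by blast
      have "cinner d z = cinner d (z - A x)"
        using d[of x] cinner.commute[of d "A x"] by (simp add: cinner.diff_right)
      then have "cmod (cinner d z) \<le> norm d * norm (z - A x)"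
        using cinner.Cauchy_Schwarz[of d "z - A x"] by simp
      also have "\<dots> \<le> norm d * (e / (norm d + 1))"
        using x by (intro mult_left_mono) (auto simp: dist_norm norm_minus_commute)
      also have "\<dots> = e * (norm d / (norm d + 1))" by simp
      also have "\<dots> \<le> e" using that
        by (intro mult_left_le) (simp_all add: divide_le_eq_1 add_nonneg_pos)
      finally show ?thesis by simp
    qed
    then have "cmod (cinner d z) \<le> 0" by (rule field_le_epsilon)
    then show ?thesis by simp
  qed
  have sub: "subspace ?M"
    using cA by (intro subspace_closure linear_subspace_image subspace_UNIV)
      (simp add: bounded_clinear_def bounded_linear.linear)
  have cM: "c *\<^sub>C z \<in> ?M" if "z \<in> ?M" for c z
  proof -
    from that obtain u where u: "\<And>n. u n \<in> range A" "u \<longlonglongrightarrow> z"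
      by (auto simp: closure_sequential)
    have "\<forall>n. c *\<^sub>C u n \<in> range A"
      using u(1) cA by (metis bounded_clinear_def imageE rangeI)
    moreover have "(\<lambda>n. c *\<^sub>C u n) \<longlonglongrightarrow> c *\<^sub>C z"
      by (rule bounded_linear.tendsto[OF bounded_linear_scaleC u(2)])
    ultimately show ?thesis unfolding closure_sequential by (intro exI conjI)
  qed
  obtain P where P: "bounded_clinear P" "\<And>x. P x \<in> ?M"
    and orth: "\<And>x z. z \<in> ?M \<Longrightarrow> cinner (x - P x) z = 0"
    using orthogonal_projection_exists[OF sub closed_closure cM] by blast
  obtain R where R: "is_A_adjoint A T R" using T by (auto simp: A_adjointable_def)
  have AP: "cinner (A x) (P y) = cinner (A x) y" for x y
  proof -
    have "cinner (y - P y) (A x) = 0" by (rule orth) (simp add: closure_subset[THEN subsetD])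
    then show ?thesis
      using cinner.commute[of "A x" "y - P y"] by (simp add: cinner.diff_right)
  qed
  have "\<exists>!R. is_A_adjoint A T R \<and> range R \<subseteq> ?M"
  proof (rule ex_ex1I)
    have "is_A_adjoint A T (\<lambda>x. P (R x))"
      using R P(1) by (simp add: is_A_adjoint_def A_inner_def AP bounded_clinear_compose)
    then show "\<exists>R. is_A_adjoint A T R \<and> range R \<subseteq> ?M" using P(2) by blast
  next
    fix R1 R2
    assume 1: "is_A_adjoint A T R1 \<and> range R1 \<subseteq> ?M" and 2: "is_A_adjoint A T R2 \<and> range R2 \<subseteq> ?M"
    show "R1 = R2"
    proof
      fix y
      have "cinner (A x) (R1 y - R2 y) = 0" for x
      proof -
        have "A_inner A x (R1 y) = A_inner A (T x) y" "A_inner A x (R2 y) = A_inner A (T x) y"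
          using 1 2 by (simp_all add: is_A_adjoint_def)
        then show ?thesis by (simp add: A_inner_def cinner.diff_right)
      qed
      moreover have "R1 y - R2 y \<in> ?M" by (rule subspace_diff[OF sub]) (use 1 2 in blast)+
      ultimately have "cinner (R1 y - R2 y) (R1 y - R2 y) = 0" by (rule ker)
      then show "R1 y = R2 y" using cinner.ip_self[of "R1 y - R2 y"] by simp
    qed
  qed
  from theI'[OF this] show ?thesis unfolding A_adj_def by blast
qed

text \<open>Boundedness for \<open>norm\<close> does not by itself pass to \<open>A_norm A\<close>;
  symmetry makes it pass, by \<open>symmetric_snorm_le\<close> with \<open>C = sqrt K\<close>, where
  \<open>K\<close> bounds \<open>A\<close>.\<close>

lemma A_symmetric_bounded:
  assumes A: "positive_op A" and B: "bounded_clinear B"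
    and sym: "\<And>x y. A_inner A (B x) y = A_inner A x (B y)"
  obtains M where "0 < M" "\<And>x. A_norm A (B x) \<le> M * A_norm A x"
proof -
  interpret A: semi_inner "A_inner A" by (rule positive_op_semi_inner[OF A])
  obtain M where M: "0 < M" "\<And>x. norm (B x) \<le> M * norm x"
    using bounded_clinear_bound[OF B] by blast
  obtain K where K: "0 < K" "\<And>x. norm (A x) \<le> K * norm x"
    using A bounded_clinear_bound[of A] unfolding positive_op_def by blast
  have C: "A.snorm x \<le> sqrt K * norm x" for x
  proof -
    have "Re (A_inner A x x) \<le> norm (A x) * norm x"
      unfolding A_inner_def by (rule cinner.Re_Cauchy_Schwarz)
    also have "\<dots> \<le> K * norm x * norm x" by (intro mult_right_mono K) simp
    finally have "A.snorm x \<le> sqrt (K * (norm x)\<^sup>2)"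
      by (simp add: A.snorm_def power2_eq_square mult.assoc)
    then show ?thesis by (simp add: real_sqrt_mult)
  qed
  show ?thesis
    using that[OF M(1)] A.symmetric_snorm_le[OF sym M(2,1) C] K(1)
    by (simp add: snorm_A_inner[OF A])
qed

section \<open>Suprema over the \<open>A\<close>-unit sphere and the numerical radius
  inequality\<close>

lemma nonneg_Sup_upper:
  assumes "x \<in> S" and "\<And>y. y \<in> S \<Longrightarrow> y \<le> b"
  shows "x \<le> nonneg_Sup S"
  using assms by (auto simp: nonneg_Sup_def intro!: cSup_upper bdd_aboveI)

lemma nonneg_Sup_nonneg:
  assumes "\<And>y. y \<in> S \<Longrightarrow> 0 \<le> y" and "\<And>y. y \<in> S \<Longrightarrow> y \<le> b"
  shows "0 \<le> nonneg_Sup S"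
proof (cases "S = {}")
  case False
  then obtain y where "y \<in> S" by blast
  with nonneg_Sup_upper[OF this assms(2)] assms(1) show ?thesis by force
qed (simp add: nonneg_Sup_def)

text \<open>The condition \<open>0 \<le> b\<close> covers the empty set, whose supremum is set to
  0.\<close>

lemma nonneg_Sup_least:
  assumes "\<And>y. y \<in> S \<Longrightarrow> y \<le> b" and "0 \<le> b"
  shows "nonneg_Sup S \<le> b"
  using assms by (auto simp: nonneg_Sup_def intro: cSup_least)

theorem theorem2p4:
  fixes A T :: "'a::complex_hilbert \<Rightarrow> 'a" and r :: real
  assumes "positive_op A"
    and "T \<in> A_adjointable A"
    and "r \<ge> 1"
  shows "A_numradius A T powr (2 * r)
    \<le> 1 / 2 * A_numradius A (T \<circ> T) powr r
      + 1 / 2 powr (r + 1) * A_opnorm A (\<lambda>x. T (A_adj A T x) + A_adj A T (T x)) powr r"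
proof -
  interpret A: semi_inner "A_inner A" by (rule positive_op_semi_inner[OF assms(1)])
  note sn = snorm_A_inner[OF assms(1)]
  define R where "R = A_adj A T"
  define S where "S x = T (R x) + R (T x)" for x
  have adj: "A_inner A (T x) y = A_inner A x (R y)" and cR: "bounded_clinear R" for x y
    using A_adj_is_A_adjoint[OF assms(1,2)] by (simp_all add: R_def is_A_adjoint_def)
  have adj': "A_inner A (R x) y = A_inner A x (T y)" for x y
    by (metis A.commute adj)
  have cT: "bounded_clinear T" using assms(2) by (simp add: A_adjointable_def)
  \<comment> \<open>\<open>T\<close> need not be \<open>A\<close>-symmetric, but \<open>R\<close>
    after \<open>T\<close> is; its bound \<open>M\<close> yields the bound \<open>sqrt M\<close> for
    \<open>T\<close> in \<open>T_le\<close>.\<close>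
  obtain M where M: "0 < M" "\<And>x. A_norm A (R (T x)) \<le> M * A_norm A x"
    by (rule A_symmetric_bounded[OF assms(1) bounded_clinear_compose[OF cR cT]])
      (simp_all add: adj adj')
  obtain L where L: "0 < L" "\<And>x. A_norm A (S x) \<le> L * A_norm A x"
    by (rule A_symmetric_bounded[OF assms(1), of S])
      (simp_all add: S_def[abs_def] bounded_clinear_sum bounded_clinear_compose cR cT
        A.add_left A.add_right adj adj')
  have T_le: "A_norm A (T x) \<le> sqrt M * A_norm A x" for x
  proof -
    have "(A_norm A (T x))\<^sup>2 \<le> A_norm A x * A_norm A (R (T x))"
      using A.Re_Cauchy_Schwarz[of x "R (T x)"] A.snorm_sq[of "T x"] by (simp add: sn adj)
    also have "\<dots> \<le> A_norm A x * (M * A_norm A x)"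
      using M(2) A.snorm_nonneg by (intro mult_left_mono) (simp_all add: sn)
    also have "\<dots> = (sqrt M * A_norm A x)\<^sup>2"
      using M(1) by (simp add: power_mult_distrib power2_eq_square)
    finally show ?thesis
      by (rule power2_le_imp_le) (use M(1) A.snorm_nonneg[of x, unfolded sn] in simp)
  qed
  define u where "u = A_numradius A (T \<circ> T)"
  define s where "s = A_opnorm A S"
  have T2_le: "cmod (A_inner A (T (T x)) x) \<le> M" if "A_norm A x = 1" for x
  proof -
    have "cmod (A_inner A (T (T x)) x) \<le> A_norm A (T (T x))"
      using A.Cauchy_Schwarz[of "T (T x)" x] that by (simp add: sn)
    also have "\<dots> \<le> sqrt M * A_norm A (T x)" by (rule T_le)
    also have "\<dots> \<le> sqrt M * (sqrt M * A_norm A x)"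
      using M(1) by (intro mult_left_mono T_le) simp
    finally show ?thesis using M(1) that by simp
  qed
  have u_upper: "cmod (A_inner A (T (T x)) x) \<le> u" if "A_norm A x = 1" for x
    unfolding u_def A_numradius_def by (rule nonneg_Sup_upper[where b = M]) (use T2_le that in auto)
  have s_upper: "A_norm A (S x) \<le> s" if "A_norm A x = 1" for x
    unfolding s_def A_opnorm_def
    by (rule nonneg_Sup_upper[where b = L]) (use L(2) that in \<open>auto, metis mult_1_right\<close>)
  have u0: "0 \<le> u"
    unfolding u_def A_numradius_def by (rule nonneg_Sup_nonneg[where b = M]) (use T2_le in auto)
  have s0: "0 \<le> s"
    unfolding s_def A_opnorm_def
    by (rule nonneg_Sup_nonneg[where b = L])
      (use L(2) A.snorm_nonneg in \<open>auto simp: sn, metis mult_1_right\<close>)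
  have pointwise: "(cmod (A_inner A (T x) x))\<^sup>2 \<le> (u + s / 2) / 2" if x: "A_norm A x = 1" for x
  proof -
    have "2 * (A_norm A (T x) * A_norm A (R x)) \<le> (A_norm A (T x))\<^sup>2 + (A_norm A (R x))\<^sup>2"
      using sum_squares_bound[of "A_norm A (T x)" "A_norm A (R x)"] by simp
    also have "\<dots> = Re (A_inner A (S x) x)"
      using A.snorm_sq[of "T x"] A.snorm_sq[of "R x"] by (simp add: sn S_def A.add_left adj adj')
    also have "\<dots> \<le> s"
      using A.Re_Cauchy_Schwarz[of "S x" x] s_upper[OF x] x by (simp add: sn)
    finally have "A_norm A (T x) * A_norm A (R x) \<le> s / 2" by simp
    \<comment> \<open>Moving \<open>R\<close> back across the form turns
      \<open>A_inner A x (R x)\<close> into \<open>A_inner A (T x) x\<close>, so the Buzano product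
      is a square, and \<open>A_inner A (T x) (R x)\<close> into
      \<open>A_inner A (T (T x)) x\<close>.\<close>
    moreover have "(cmod (A_inner A (T x) x))\<^sup>2
        \<le> (A_norm A (T x) * A_norm A (R x) + cmod (A_inner A (T (T x)) x)) / 2"
      using A.Buzano[of x "T x" "R x"] x
      by (simp add: sn adj[symmetric] norm_mult power2_eq_square)
    ultimately show ?thesis using u_upper[OF x] by simp
  qed
  \<comment> \<open>Square roots are taken since the supremum \<open>w\<close> runs over unsquared
    values.\<close>
  have sqrt_le: "cmod (A_inner A (T x) x) \<le> sqrt ((u + s / 2) / 2)" if "A_norm A x = 1" for x
    using pointwise[OF that] by (rule real_le_rsqrt)
  define w where "w = A_numradius A T"
  have w0: "0 \<le> w"
    unfolding w_def A_numradius_def by (rule nonneg_Sup_nonneg) (use sqrt_le in auto)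
  have "w \<le> sqrt ((u + s / 2) / 2)"
    unfolding w_def A_numradius_def by (rule nonneg_Sup_least) (use sqrt_le u0 s0 in auto)
  then have "w\<^sup>2 \<le> (sqrt ((u + s / 2) / 2))\<^sup>2" using w0 by (intro power_mono)
  then have w2: "w\<^sup>2 \<le> (u + s / 2) / 2" using u0 s0 by simp
  have "w powr (2 * r) = (w\<^sup>2) powr r"
    using w0 by (simp add: powr_powr[symmetric] powr_numeral)
  also have "\<dots> \<le> ((u + s / 2) / 2) powr r" using w2 assms(3) by (intro powr_mono2) auto
  also have "\<dots> \<le> (u powr r + (s / 2) powr r) / 2"
    using u0 s0 assms(3) by (intro powr_mean_le) auto
  \<comment> \<open>The halving inside the power and the one from the mean combine to
    \<open>2 powr (r + 1)\<close>.\<close>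
  also have "\<dots> = 1 / 2 * u powr r + 1 / 2 powr (r + 1) * s powr r"
    using s0 by (simp add: powr_divide powr_add field_simps)
  finally show ?thesis by (simp add: w_def u_def s_def S_def[abs_def] R_def)
qed

end
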